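(* (In $\mathrm{ZF}$.) For all $k,n\in\omega$, $\mathrm{nRC_{fin}}$ implies $\mathrm{knRC_{fin}}$ (the principle $\mathrm{mRC_{fin}}$ for $m=kn$).
   Context: The base theory is $\mathrm{ZF}$ (no Axiom of Choice). For a set $x$ and $n\in\omega$, $[x]^n$ is the set of all $n$-element subsets of $x$ and $[x]^{>n}$ is the set of all finite subsets of $x$ with more than $n$ elements. $\mathrm{nRC_{fin}}$: given any infinite set $x$, there exist an infinite subset $y\subseteq x$ and a function $f\colon[y]^{>n}\to[y]^n$ such that $f(z)\subseteq z$ for all $z\in[y]^{>n}$. *)

theory Defs
  imports Main
begin

text \<open>
  HOL proves the Axiom of Choice, so a theorem of ZF about choice principles cannot be stated
  about HOL sets without becoming trivial.  It is stated here about an arbitrary model of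
  first-order ZF: a type \<open>'a\<close> together with a binary relation on it that satisfies the axioms
  of ZF.  By soundness and completeness of first-order logic, holding in all such models is the
  same as being provable in ZF.

  All set-theoretic notions below are the usual first-order formulas of set theory with every
  quantifier ranging over the model.  In particular functions, finiteness, and \<open>\<omega>\<close> are those of
  the model: \<open>\<omega>\<close> may contain nonstandard elements, and a set that is finite in the sense of the
  model need not have finitely many members in the sense of HOL.
\<close>

datatype fm = Mem nat nat | Eq nat nat | Neg fm | And fm fm | All nat fm

context
  fixes mem :: "'a \<Rightarrow> 'a \<Rightarrow> bool" (infix "\<^bold>\<in>" 50)
begin

primrec sat :: "(nat \<Rightarrow> 'a) \<Rightarrow> fm \<Rightarrow> bool" where
  "sat v (Mem i j) \<longleftrightarrow> v i \<^bold>\<in> v j"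
| "sat v (Eq i j) \<longleftrightarrow> v i = v j"
| "sat v (Neg \<phi>) \<longleftrightarrow> \<not> sat v \<phi>"
| "sat v (And \<phi> \<psi>) \<longleftrightarrow> sat v \<phi> \<and> sat v \<psi>"
| "sat v (All i \<phi>) \<longleftrightarrow> (\<forall>a. sat (v(i := a)) \<phi>)"

definition is_sub :: "'a \<Rightarrow> 'a \<Rightarrow> bool" where
  "is_sub x y \<longleftrightarrow> (\<forall>z. z \<^bold>\<in> x \<longrightarrow> z \<^bold>\<in> y)"

definition is_empty :: "'a \<Rightarrow> bool" where
  "is_empty e \<longleftrightarrow> (\<forall>z. \<not> z \<^bold>\<in> e)"

definition is_upair :: "'a \<Rightarrow> 'a \<Rightarrow> 'a \<Rightarrow> bool" where
  "is_upair p a b \<longleftrightarrow> (\<forall>z. z \<^bold>\<in> p \<longleftrightarrow> z = a \<or> z = b)"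

text \<open>Kuratowski pairs: \<open>p = {{a}, {a, b}}\<close>.\<close>

definition is_opair :: "'a \<Rightarrow> 'a \<Rightarrow> 'a \<Rightarrow> bool" where
  "is_opair p a b \<longleftrightarrow> (\<exists>u w. is_upair u a a \<and> is_upair w a b \<and> is_upair p u w)"

definition is_succ :: "'a \<Rightarrow> 'a \<Rightarrow> bool" where
  "is_succ s a \<longleftrightarrow> (\<forall>z. z \<^bold>\<in> s \<longleftrightarrow> z \<^bold>\<in> a \<or> z = a)"

definition is_inductive :: "'a \<Rightarrow> bool" where
  "is_inductive I \<longleftrightarrow> (\<exists>e. is_empty e \<and> e \<^bold>\<in> I)
    \<and> (\<forall>a. a \<^bold>\<in> I \<longrightarrow> (\<exists>s. is_succ s a \<and> s \<^bold>\<in> I))"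

text \<open>
  The axioms of ZF.  In the two schemas the assignment \<open>v\<close> supplies the parameters: variable 0
  (and 1, for Replacement) is reserved for the arguments of the formula, and all other variables
  may occur as parameters.  The schemas range over first-order formulas only; with arbitrary
  HOL predicates in place of \<open>\<phi>\<close>, Choice would hold in every model.
\<close>

definition ZF_model :: bool where
  "ZF_model \<longleftrightarrow>
    \<comment> \<open>Extensionality\<close>
    (\<forall>x y. (\<forall>z. z \<^bold>\<in> x \<longleftrightarrow> z \<^bold>\<in> y) \<longrightarrow> x = y) \<and>
    \<comment> \<open>Foundation\<close>
    (\<forall>x. (\<exists>y. y \<^bold>\<in> x) \<longrightarrow> (\<exists>y. y \<^bold>\<in> x \<and> \<not> (\<exists>z. z \<^bold>\<in> x \<and> z \<^bold>\<in> y))) \<and>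
    \<comment> \<open>Pairing\<close>
    (\<forall>a b. \<exists>p. is_upair p a b) \<and>
    \<comment> \<open>Union\<close>
    (\<forall>x. \<exists>u. \<forall>z. z \<^bold>\<in> u \<longleftrightarrow> (\<exists>y. y \<^bold>\<in> x \<and> z \<^bold>\<in> y)) \<and>
    \<comment> \<open>Power Set\<close>
    (\<forall>x. \<exists>p. \<forall>z. z \<^bold>\<in> p \<longleftrightarrow> is_sub z x) \<and>
    \<comment> \<open>Infinity\<close>
    (\<exists>I. is_inductive I) \<and>
    \<comment> \<open>Separation\<close>
    (\<forall>\<phi> v a. \<exists>b. \<forall>x. x \<^bold>\<in> b \<longleftrightarrow> x \<^bold>\<in> a \<and> sat (v(0 := x)) \<phi>) \<and>
    \<comment> \<open>Replacement\<close>
    (\<forall>\<phi> v a.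
      (\<forall>x y y'. x \<^bold>\<in> a \<longrightarrow> sat (v(0 := x, 1 := y)) \<phi> \<longrightarrow> sat (v(0 := x, 1 := y')) \<phi> \<longrightarrow> y = y') \<longrightarrow>
      (\<exists>b. \<forall>y. y \<^bold>\<in> b \<longleftrightarrow> (\<exists>x. x \<^bold>\<in> a \<and> sat (v(0 := x, 1 := y)) \<phi>)))"

text \<open>\<open>\<omega>\<close> is the intersection of all inductive sets.\<close>

definition in_omega :: "'a \<Rightarrow> bool" where
  "in_omega n \<longleftrightarrow> (\<forall>I. is_inductive I \<longrightarrow> n \<^bold>\<in> I)"

definition maps_to :: "'a \<Rightarrow> 'a \<Rightarrow> 'a \<Rightarrow> bool" where
  "maps_to f x y \<longleftrightarrow> (\<exists>p. is_opair p x y \<and> p \<^bold>\<in> f)"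

definition is_fun :: "'a \<Rightarrow> 'a \<Rightarrow> 'a \<Rightarrow> bool" where
  "is_fun f a b \<longleftrightarrow>
    (\<forall>p. p \<^bold>\<in> f \<longrightarrow> (\<exists>x y. x \<^bold>\<in> a \<and> y \<^bold>\<in> b \<and> is_opair p x y)) \<and>
    (\<forall>x. x \<^bold>\<in> a \<longrightarrow> (\<exists>!y. maps_to f x y))"

definition is_bij :: "'a \<Rightarrow> 'a \<Rightarrow> 'a \<Rightarrow> bool" where
  "is_bij f a b \<longleftrightarrow> is_fun f a b \<and> (\<forall>y. y \<^bold>\<in> b \<longrightarrow> (\<exists>!x. maps_to f x y))"

definition equinumerous :: "'a \<Rightarrow> 'a \<Rightarrow> bool" where
  "equinumerous a b \<longleftrightarrow> (\<exists>f. is_bij f a b)"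

definition is_infinite :: "'a \<Rightarrow> bool" where
  "is_infinite x \<longleftrightarrow> \<not> (\<exists>n. in_omega n \<and> equinumerous x n)"

text \<open>\<open>s = [x]\<^sup>n\<close>, for \<open>n \<in> \<omega>\<close>.\<close>

definition is_subsets_eq :: "'a \<Rightarrow> 'a \<Rightarrow> 'a \<Rightarrow> bool" where
  "is_subsets_eq s x n \<longleftrightarrow> (\<forall>z. z \<^bold>\<in> s \<longleftrightarrow> is_sub z x \<and> equinumerous z n)"

text \<open>\<open>s = [x]\<^bsup>>n\<^esup>\<close>, for \<open>n \<in> \<omega>\<close>; the order on \<open>\<omega>\<close> is membership.\<close>

definition is_subsets_gt :: "'a \<Rightarrow> 'a \<Rightarrow> 'a \<Rightarrow> bool" where
  "is_subsets_gt s x n \<longleftrightarrow>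
    (\<forall>z. z \<^bold>\<in> s \<longleftrightarrow> is_sub z x \<and> (\<exists>m. in_omega m \<and> n \<^bold>\<in> m \<and> equinumerous z m))"

definition nRC_fin :: "'a \<Rightarrow> bool" where
  "nRC_fin n \<longleftrightarrow>
    (\<forall>x. is_infinite x \<longrightarrow>
      (\<exists>y f a b. is_sub y x \<and> is_infinite y \<and>
        is_subsets_gt a y n \<and> is_subsets_eq b y n \<and> is_fun f a b \<and>
        (\<forall>z w. z \<^bold>\<in> a \<longrightarrow> maps_to f z w \<longrightarrow> is_sub w z)))"

definition is_product :: "'a \<Rightarrow> 'a \<Rightarrow> 'a \<Rightarrow> bool" where
  "is_product c a b \<longleftrightarrow> (\<forall>p. p \<^bold>\<in> c \<longleftrightarrow> (\<exists>x y. x \<^bold>\<in> a \<and> y \<^bold>\<in> b \<and> is_opair p x y))"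

text \<open>
  \<open>m = k n\<close>, for \<open>k, n \<in> \<omega>\<close>: the product of finite cardinals, that is, the \<open>m \<in> \<omega>\<close> with
  \<open>\<bar>m\<bar> = \<bar>k \<times> n\<bar>\<close>.  In a model of ZF there is exactly one such \<open>m\<close>.
\<close>

definition is_mult :: "'a \<Rightarrow> 'a \<Rightarrow> 'a \<Rightarrow> bool" where
  "is_mult m k n \<longleftrightarrow> in_omega m \<and> (\<exists>c. is_product c k n \<and> equinumerous c m)"

end

end

theory Submission
  imports Defs
begin

text \<open>
  Let \<open>f\<close> choose an \<open>n\<close>-element subset of every finite subset of \<open>y\<close> with more than \<open>n\<close> elements.
  On the same \<open>y\<close>, induction on \<open>k\<close> inside the model yields a function \<open>g\<^sub>k\<close> that chooses subsets of
  size \<open>kn\<close>, with \<open>g\<^sub>k\<^sub>+\<^sub>1(z) = g\<^sub>k(z) \<union> f(z - g\<^sub>k(z))\<close>.  Only the existence of some \<open>g\<^sub>k\<close> enters the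
  induction, so neither recursion nor choice is needed.  Since \<open>\<omega>\<close> may be nonstandard, the
  induction and the finite cardinal arithmetic behind it are internal, and every predicate fed to
  Separation has to be shown first-order definable.
\<close>

section \<open>First-order definability\<close>

primrec rename :: "(nat \<Rightarrow> nat) \<Rightarrow> fm \<Rightarrow> fm" where
  "rename \<rho> (Mem i j) = Mem (\<rho> i) (\<rho> j)"
| "rename \<rho> (Eq i j) = Eq (\<rho> i) (\<rho> j)"
| "rename \<rho> (Neg \<phi>) = Neg (rename \<rho> \<phi>)"
| "rename \<rho> (And \<phi> \<psi>) = And (rename \<rho> \<phi>) (rename \<rho> \<psi>)"
| "rename \<rho> (All i \<phi>) = All (\<rho> i) (rename \<rho> \<phi>)"

text \<open>Bound variables are renamed together with free ones. Injectivity of the renaming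
  excludes capture: an update at the image of \<open>j\<close> is seen only by variable
  \<open>j\<close>.\<close>

lemma sat_rename:
  assumes "inj \<rho>"
  shows "sat mem v (rename \<rho> \<phi>) \<longleftrightarrow> sat mem (\<lambda>i. v (\<rho> i)) \<phi>"
proof (induction \<phi> arbitrary: v)
  case (All j \<phi>)
  have "(\<lambda>i. (v(\<rho> j := a)) (\<rho> i)) = (\<lambda>i. v (\<rho> i))(j := a)" for a
    using assms by (auto simp: fun_eq_iff inj_eq)
  then show ?case using All by simp
qed auto

text \<open>Parameters occupy the first variables and the assignment follows them. As formulas have
  no constants, lists of parameters are merged or extended by renaming variables.\<close>

definition env :: "'a list \<Rightarrow> (nat \<Rightarrow> 'a) \<Rightarrow> nat \<Rightarrow> 'a" where
  "env ws v i = (if i < length ws then ws ! i else v (i - length ws))"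

locale zf =
  fixes mem :: "'a \<Rightarrow> 'a \<Rightarrow> bool" (infix "\<^bold>\<in>" 50)
  assumes ZF: "ZF_model mem"
begin

text \<open>
  \<open>dfb R\<close>: the predicate \<open>R\<close> of an assignment is first-order definable with parameters \<open>ws\<close>.
  Quantifiers follow the de Bruijn convention: the bound variable becomes variable 0 and all
  others move up by one, so the closure rules below decompose a HOL formula by unification alone.
\<close>

definition dfb :: "((nat \<Rightarrow> 'a) \<Rightarrow> bool) \<Rightarrow> bool" where
  "dfb R \<longleftrightarrow> (\<exists>\<phi> ws. \<forall>v. R v \<longleftrightarrow> sat mem (env ws v) \<phi>)"

named_theorems dfb_intros

lemma dfbI:
  assumes "inj \<rho>" and "\<And>v. R v \<longleftrightarrow> sat mem (\<lambda>i. env ws v (\<rho> i)) \<phi>"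
  shows "dfb R"
  unfolding dfb_def by (intro exI[of _ "rename \<rho> \<phi>"] exI[of _ ws]) (simp add: assms sat_rename)

lemma dfb_rename:
  assumes "dfb R" "inj \<rho>"
  shows "dfb (\<lambda>v. R (\<lambda>i. v (\<rho> i)))"
proof -
  obtain \<phi> ws where *: "\<And>v. R v \<longleftrightarrow> sat mem (env ws v) \<phi>"
    using assms(1) unfolding dfb_def by blast
  \<comment> \<open>The parameter places stay fixed and \<open>\<rho>\<close> acts only on the
    variables behind them.\<close>
  let ?r = "\<lambda>i. if i < length ws then i else length ws + \<rho> (i - length ws)"
  have "inj ?r"
  proof (rule injI)
    fix i j assume "?r i = ?r j"
    then show "i = j"
      using injD[OF assms(2), of "i - length ws" "j - length ws"] by (auto split: if_splits)
  qed
  moreover have "env ws (\<lambda>i. v (\<rho> i)) = (\<lambda>i. env ws v (?r i))" for v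
    by (auto simp: env_def)
  ultimately show ?thesis by (intro dfbI[of ?r _ ws \<phi>]) (auto simp: *)
qed

lemma dfb_shift: "dfb R \<Longrightarrow> dfb (\<lambda>v. R (\<lambda>i. v (Suc i)))"
  by (rule dfb_rename) simp_all

lemma dfb_not [dfb_intros]:
  assumes "dfb R" shows "dfb (\<lambda>v. \<not> R v)"
proof -
  obtain \<phi> ws where "\<And>v. R v \<longleftrightarrow> sat mem (env ws v) \<phi>"
    using assms(1) unfolding dfb_def by blast
  then have "\<not> R v \<longleftrightarrow> sat mem (env ws v) (Neg \<phi>)" for v by simp
  then show ?thesis unfolding dfb_def by blast
qed

lemma dfb_conj [dfb_intros]:
  assumes "dfb R" "dfb S" shows "dfb (\<lambda>v. R v \<and> S v)"
proof -
  obtain \<phi> ws where 1: "\<And>v. R v \<longleftrightarrow> sat mem (env ws v) \<phi>"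
    using assms(1) unfolding dfb_def by blast
  obtain \<psi> us where 2: "\<And>v. S v \<longleftrightarrow> sat mem (env us v) \<psi>"
    using assms(2) unfolding dfb_def by blast
  \<comment> \<open>Both formulas are brought to the joint parameter list \<open>ws @ us\<close>:
    \<open>?r\<close> jumps over the block \<open>us\<close>, and \<open>?s\<close> moves everything
    past \<open>ws\<close>.\<close>
  let ?r = "\<lambda>i. if i < length ws then i else i + length us"
  let ?s = "\<lambda>i. i + length ws"
  have r: "inj ?r" and s: "inj ?s"
    by (auto simp: inj_def)
  have "env ws v = (\<lambda>i. env (ws @ us) v (?r i))" "env us v = (\<lambda>i. env (ws @ us) v (?s i))" for v
    by (auto simp: env_def nth_append)
  then have "R v \<and> S v \<longleftrightarrow> sat mem (env (ws @ us) v) (And (rename ?r \<phi>) (rename ?s \<psi>))" for v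
    by (simp add: 1 2 sat_rename[OF r] sat_rename[OF s])
  then show ?thesis unfolding dfb_def by blast
qed

text \<open>The additional parameter \<open>undefined\<close> only serves to free variable 0.\<close>

lemma dfb_case_nat:
  assumes "dfb (\<lambda>v. R (\<lambda>i. v (Suc i)) (v 0))"
  shows "\<exists>\<phi> ws. \<forall>v a. R v a \<longleftrightarrow> sat mem ((env ws v)(0 := a)) \<phi>"
proof -
  obtain \<phi> ws where 1: "\<And>v. R (\<lambda>i. v (Suc i)) (v 0) \<longleftrightarrow> sat mem (env ws v) \<phi>"
    using assms(1) unfolding dfb_def by blast
  let ?l = "length ws"
  let ?r = "\<lambda>i. if i < ?l then Suc i else if i = ?l then 0 else i"
  have r: "inj ?r"
    by (auto simp: inj_def)
  have "env ws (case_nat a v) i = ((env (undefined # ws) v)(0 := a)) (?r i)" for v a i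
  proof -
    consider "i < ?l" | "i = ?l" | j where "i = Suc ?l + j"
      by (metis not_less_eq le_add_diff_inverse not_le less_antisym)
    then show ?thesis by cases (auto simp: env_def Suc_diff_le)
  qed
  then have "env ws (case_nat a v) = (\<lambda>i. ((env (undefined # ws) v)(0 := a)) (?r i))" for v a
    by blast
  with 1[of "case_nat a v" for a v]
  have "R v a \<longleftrightarrow> sat mem ((env (undefined # ws) v)(0 := a)) (rename ?r \<phi>)" for v a
    by (simp add: sat_rename[OF r])
  then show ?thesis by blast
qed

lemma dfb_all [dfb_intros]:
  assumes "dfb (\<lambda>v. R (\<lambda>i. v (Suc i)) (v 0))"
  shows "dfb (\<lambda>v. \<forall>a. R v a)"
proof -
  obtain \<phi> ws where "\<And>v a. R v a \<longleftrightarrow> sat mem ((env ws v)(0 := a)) \<phi>"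
    using dfb_case_nat[OF assms] by blast
  then have "(\<forall>a. R v a) \<longleftrightarrow> sat mem (env ws v) (All 0 \<phi>)" for v
    by simp
  then show ?thesis unfolding dfb_def by blast
qed

lemma dfb_ex [dfb_intros]:
  assumes "dfb (\<lambda>v. R (\<lambda>i. v (Suc i)) (v 0))"
  shows "dfb (\<lambda>v. \<exists>a. R v a)"
proof -
  have "dfb (\<lambda>v. \<not> (\<forall>a. \<not> R v a))"
    by (intro dfb_not dfb_all assms)
  then show ?thesis by simp
qed

lemma dfb_disj [dfb_intros]: "dfb R \<Longrightarrow> dfb S \<Longrightarrow> dfb (\<lambda>v. R v \<or> S v)"
proof -
  assume "dfb R" "dfb S"
  then have "dfb (\<lambda>v. \<not> (\<not> R v \<and> \<not> S v))"
    by (intro dfb_not dfb_conj)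
  then show ?thesis by simp
qed

lemma dfb_imp [dfb_intros]: "dfb R \<Longrightarrow> dfb S \<Longrightarrow> dfb (\<lambda>v. R v \<longrightarrow> S v)"
  unfolding imp_conv_disj by (intro dfb_disj dfb_not)

lemma dfb_iff [dfb_intros]: "dfb R \<Longrightarrow> dfb S \<Longrightarrow> dfb (\<lambda>v. R v \<longleftrightarrow> S v)"
  unfolding iff_conv_conj_imp by (intro dfb_conj dfb_imp)

lemma dfb_mem_var: "dfb (\<lambda>v. v i \<^bold>\<in> v j)"
  unfolding dfb_def by (intro exI[of _ "Mem i j"] exI[of _ "[]"]) (simp add: env_def)

lemma dfb_eq_var: "dfb (\<lambda>v. v i = v j)"
  unfolding dfb_def by (intro exI[of _ "Eq i j"] exI[of _ "[]"]) (simp add: env_def)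

text \<open>\<open>dft t\<close>: the function \<open>t\<close> of an assignment has a definable graph.\<close>

definition dft :: "((nat \<Rightarrow> 'a) \<Rightarrow> 'a) \<Rightarrow> bool" where
  "dft t \<longleftrightarrow> dfb (\<lambda>v. v 0 = t (\<lambda>i. v (Suc i)))"

lemma dft_var [dfb_intros]: "dft (\<lambda>v. v i)"
  unfolding dft_def by (rule dfb_eq_var)

lemma dft_const [dfb_intros]: "dft (\<lambda>v. c)"
  unfolding dft_def dfb_def by (intro exI[of _ "Eq 1 0"] exI[of _ "[c]"]) (simp add: env_def)

text \<open>The language has no function symbols, so a term is substituted by naming its value with
  an existential quantifier.\<close>

lemma dfb_subst:
  assumes "dfb (\<lambda>v. R (\<lambda>i. v (Suc i)) (v 0))" "dft t"
  shows "dfb (\<lambda>v. R v (t v))"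
proof -
  have "dfb (\<lambda>v. \<exists>a. a = t v \<and> R v a)"
    using assms unfolding dft_def by (intro dfb_intros)
  then show ?thesis by simp
qed

lemma dft_shift: "dft t \<Longrightarrow> dft (\<lambda>v. t (\<lambda>i. v (Suc i)))"
proof -
  assume "dft t"
  \<comment> \<open>Variable 0 holds the value of the term and must stay; the shift opens a gap at
    variable 1.\<close>
  moreover have "inj (\<lambda>i. if i = 0 then 0 else Suc i)" by (auto simp: inj_def)
  ultimately show ?thesis
    unfolding dft_def by (auto dest: dfb_rename)
qed

lemma dfb_subst1:
  assumes "dfb (\<lambda>v. P (v 0))" "dft s"
  shows "dfb (\<lambda>v. P (s v))"
  by (rule dfb_subst[where R = "\<lambda>_. P", OF assms])

text \<open>Reduces definability of a relation on arbitrary terms to the case of bare variables. The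
  last term is substituted first, so each earlier term is shifted past the places opened before
  it.\<close>

lemma dfb_subst2:
  assumes "dfb (\<lambda>v. P (v 0) (v (Suc 0)))" "dft s" "dft t"
  shows "dfb (\<lambda>v. P (s v) (t v))"
proof (rule dfb_subst[OF _ assms(3)], rule dfb_subst[OF _ dft_shift[OF assms(2)]])
  show "dfb (\<lambda>v. P (v 0) (v (Suc 0)))" by fact
qed

lemma dfb_subst3:
  assumes "dfb (\<lambda>v. P (v 0) (v (Suc 0)) (v (Suc (Suc 0))))" "dft s" "dft t" "dft u"
  shows "dfb (\<lambda>v. P (s v) (t v) (u v))"
proof (rule dfb_subst[OF _ assms(4)], rule dfb_subst[OF _ dft_shift[OF assms(3)]],
    rule dfb_subst[OF _ dft_shift[OF dft_shift[OF assms(2)]]])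
  show "dfb (\<lambda>v. P (v 0) (v (Suc 0)) (v (Suc (Suc 0))))" by fact
qed

lemma dfb_mem [dfb_intros]: "dft s \<Longrightarrow> dft t \<Longrightarrow> dfb (\<lambda>v. s v \<^bold>\<in> t v)"
  by (rule dfb_subst2[where P = mem, OF dfb_mem_var])

lemma dfb_eq [dfb_intros]: "dft s \<Longrightarrow> dft t \<Longrightarrow> dfb (\<lambda>v. s v = t v)"
  by (rule dfb_subst2[where P = "(=)", OF dfb_eq_var])

lemma dfb_ex1 [dfb_intros]:
  assumes "dfb (\<lambda>v. R (\<lambda>i. v (Suc i)) (v 0))"
  shows "dfb (\<lambda>v. \<exists>!a. R v a)"
proof -
  \<comment> \<open>The uniqueness clause puts a second binder under the first; the renaming skips
    the outer bound variable.\<close>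
  have "inj (\<lambda>i. if i = 0 then 0 else Suc i)" by (auto simp: inj_def)
  from dfb_rename[OF assms this]
  have "dfb (\<lambda>v. R (\<lambda>i. v (Suc (Suc i))) (v 0))" by simp
  then show ?thesis
    unfolding Ex1_def by (intro dfb_intros assms)
qed

lemma dft_if [dfb_intros]:
  assumes "dfb P" "dft s" "dft t"
  shows "dft (\<lambda>v. if P v then s v else t v)"
proof -
  have "dfb (\<lambda>v. (P (\<lambda>i. v (Suc i)) \<and> v 0 = s (\<lambda>i. v (Suc i)))
    \<or> (\<not> P (\<lambda>i. v (Suc i)) \<and> v 0 = t (\<lambda>i. v (Suc i))))"
    using dfb_shift[OF assms(1)] assms(2,3) unfolding dft_def
    by (intro dfb_disj dfb_conj dfb_not)
  moreover have "P \<and> a = b \<or> \<not> P \<and> a = c \<longleftrightarrow> a = (if P then b else c)" for P and a b c :: 'a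
    by simp
  ultimately show ?thesis unfolding dft_def by simp
qed

text \<open>
  Unlike \<open>THE\<close>, whose value on an improper predicate may vary with the predicate, this operator
  has a fixed default, which makes it definable.
\<close>

definition the1 :: "('a \<Rightarrow> bool) \<Rightarrow> 'a" where
  "the1 Q = (if \<exists>!x. Q x then THE x. Q x else undefined)"

lemma the1I: "\<exists>!x. Q x \<Longrightarrow> Q (the1 Q)"
  unfolding the1_def by (simp add: theI')

lemma the1_equality: "\<exists>!x. Q x \<Longrightarrow> Q x \<Longrightarrow> the1 Q = x"
  unfolding the1_def by auto

lemma dft_the1 [dfb_intros]:
  assumes "dfb (\<lambda>v. Q (\<lambda>i. v (Suc i)) (v 0))"
  shows "dft (\<lambda>v. the1 (\<lambda>x. Q v x))"
proof -
  have 1: "dfb (\<lambda>v. \<exists>!x. Q (\<lambda>i. v (Suc i)) x)"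
    using dfb_shift[OF dfb_ex1[OF assms]] .
  have "dfb (\<lambda>v. (\<exists>!x. Q (\<lambda>i. v (Suc i)) x) \<and> Q (\<lambda>i. v (Suc i)) (v 0)
    \<or> \<not> (\<exists>!x. Q (\<lambda>i. v (Suc i)) x) \<and> v 0 = undefined)"
    by (rule dfb_disj dfb_conj dfb_not 1 assms dfb_intros)+
  moreover have "(\<exists>!x. P x) \<and> P y \<or> \<not> (\<exists>!x. P x) \<and> y = undefined \<longleftrightarrow> y = the1 P" for P y
  proof (cases "\<exists>!x. P x")
    case True
    then show ?thesis using the1I[OF True] True by blast
  next
    case False
    then show ?thesis by (simp add: the1_def)
  qed
  ultimately show ?thesis unfolding dft_def by simp
qed

lemma dft_subst1: 
  assumes "dft (\<lambda>v. F (v 0))" "dft s"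
  shows "dft (\<lambda>v. F (s v))"
proof -
  have "dfb (\<lambda>v. v 0 = F (v (Suc 0)))" using assms(1) by (simp add: dft_def)
  from dfb_subst2[OF this dft_var dft_shift[OF assms(2)]]
  show ?thesis by (simp add: dft_def)
qed

lemma dft_subst2: 
  assumes "dft (\<lambda>v. F (v 0) (v (Suc 0)))" "dft s" "dft t"
  shows "dft (\<lambda>v. F (s v) (t v))"
proof -
  have "dfb (\<lambda>v. v 0 = F (v (Suc 0)) (v (Suc (Suc 0))))" using assms(1) by (simp add: dft_def)
  from dfb_subst3[OF this dft_var dft_shift[OF assms(2)] dft_shift[OF assms(3)]]
  show ?thesis by (simp add: dft_def)
qed

section \<open>Sets, pairs and functions of the model\<close>

lemma separation:
  assumes "dfb (\<lambda>v. P (v 0))"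
  shows "\<exists>b. \<forall>x. x \<^bold>\<in> b \<longleftrightarrow> x \<^bold>\<in> a \<and> P x"
proof -
  obtain \<phi> ws where "\<And>v x. P x \<longleftrightarrow> sat mem ((env ws v)(0 := x)) \<phi>"
    using dfb_case_nat[of "\<lambda>v. P"] assms by blast
  then have *: "P x \<longleftrightarrow> sat mem ((env ws undefined)(0 := x)) \<phi>" for x .
  have "\<forall>\<phi> v a. \<exists>b. \<forall>x. x \<^bold>\<in> b \<longleftrightarrow> x \<^bold>\<in> a \<and> sat mem (v(0 := x)) \<phi>"
    using ZF unfolding ZF_model_def by (elim conjE) assumption
  then show ?thesis unfolding * by blast
qed

lemma replacement:
  assumes "dft (\<lambda>v. F (v 0))"
  shows "\<exists>b. \<forall>y. y \<^bold>\<in> b \<longleftrightarrow> (\<exists>x. x \<^bold>\<in> a \<and> y = F x)"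
proof -
  obtain \<phi> ws where 1: "\<And>v. v 0 = F (v 1) \<longleftrightarrow> sat mem (env ws v) \<phi>"
    using assms(1) unfolding dft_def dfb_def by auto
  let ?l = "length ws"
  \<comment> \<open>In the graph of \<open>F\<close> the value is variable 0 and the argument
    variable 1; Replacement has them the other way round. Two dummy parameters free both places, and
    \<open>u\<close> fills the variables beyond.\<close>
  let ?r = "\<lambda>i. if i < ?l then Suc (Suc i) else if i = ?l then 1 else if i = Suc ?l then 0 else i"
  define u :: "nat \<Rightarrow> 'a" where "u = undefined"
  have r: "inj ?r"
    by (auto simp: inj_def)
  have "env ws (case_nat y (case_nat x u)) i
    = ((env (undefined # undefined # ws) u)(0 := x, 1 := y)) (?r i)" for x y i
  proof -
    consider "i < ?l" | "i = ?l" | "i = Suc ?l" | j where "i = Suc (Suc ?l) + j"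
      by (metis less_Suc_eq not_less_eq le_add_diff_inverse not_le)
    then show ?thesis by cases (auto simp: env_def Suc_diff_le)
  qed
  then have 2: "env ws (case_nat y (case_nat x u))
    = (\<lambda>i. ((env (undefined # undefined # ws) u)(0 := x, 1 := y)) (?r i))" for x y
    by blast
  have 3: "y = F x
    \<longleftrightarrow> sat mem ((env (undefined # undefined # ws) u)(0 := x, 1 := y)) (rename ?r \<phi>)" for x y
    unfolding sat_rename[OF r] 2[symmetric] 1[symmetric] by simp
  have "\<forall>\<phi> v a.
      (\<forall>x y y'. x \<^bold>\<in> a \<longrightarrow> sat mem (v(0 := x, 1 := y)) \<phi> \<longrightarrow> sat mem (v(0 := x, 1 := y')) \<phi> \<longrightarrow> y = y') \<longrightarrow>
      (\<exists>b. \<forall>y. y \<^bold>\<in> b \<longleftrightarrow> (\<exists>x. x \<^bold>\<in> a \<and> sat mem (v(0 := x, 1 := y)) \<phi>))"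
    using ZF unfolding ZF_model_def by (elim conjE) assumption
  from this[rule_format, of a "env (undefined # undefined # ws) u" "rename ?r \<phi>", folded 3]
  show ?thesis by blast
qed

text \<open>Elements of the model are handled as HOL sets, so that inclusions and unions become
  ordinary HOL set algebra. Not every HOL set is an \<open>ext a\<close>, hence the existence lemmas
  below.\<close>

definition ext :: "'a \<Rightarrow> 'a set" where
  "ext a = {z. z \<^bold>\<in> a}"

lemma mem_ext [simp]: "x \<in> ext a \<longleftrightarrow> x \<^bold>\<in> a"
  by (simp add: ext_def)

lemma ext_inject [simp]: "ext a = ext b \<longleftrightarrow> a = b"
proof -
  have "\<forall>x y. (\<forall>z. z \<^bold>\<in> x \<longleftrightarrow> z \<^bold>\<in> y) \<longrightarrow> x = y"
    using ZF unfolding ZF_model_def by (elim conjE) assumption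
  then show ?thesis by (auto simp: set_eq_iff)
qed

lemma ex_separation: "dfb (\<lambda>v. P (v 0)) \<Longrightarrow> \<exists>b. ext b = {x. x \<^bold>\<in> a \<and> P x}"
  using separation[of P a] by (auto simp: set_eq_iff)

lemma ex_image: "dft (\<lambda>v. F (v 0)) \<Longrightarrow> \<exists>b. ext b = F ` ext a"
  using replacement[of F a] by (auto simp: set_eq_iff image_iff Bex_def)

lemma ex_upair: "\<exists>p. ext p = {a, b}"
proof -
  have "\<forall>a b. \<exists>p. is_upair mem p a b"
    using ZF unfolding ZF_model_def by (elim conjE) assumption
  then show ?thesis by (auto simp: set_eq_iff is_upair_def)
qed

lemma ex_un: "\<exists>u. ext u = ext a \<union> ext b"
proof -
  have "\<forall>x. \<exists>u. \<forall>z. z \<^bold>\<in> u \<longleftrightarrow> (\<exists>y. y \<^bold>\<in> x \<and> z \<^bold>\<in> y)"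
    using ZF unfolding ZF_model_def by (elim conjE) assumption
  moreover obtain p where "ext p = {a, b}"
    using ex_upair by blast
  ultimately have "\<exists>u. \<forall>z. z \<^bold>\<in> u \<longleftrightarrow> z \<^bold>\<in> a \<or> z \<^bold>\<in> b"
    by (auto simp: set_eq_iff) (metis (no_types, lifting))
  then show ?thesis by (auto simp: set_eq_iff)
qed

lemma ex_pow: "\<exists>p. \<forall>z. z \<^bold>\<in> p \<longleftrightarrow> ext z \<subseteq> ext x"
proof -
  have "\<forall>x. \<exists>p. \<forall>z. z \<^bold>\<in> p \<longleftrightarrow> is_sub mem z x"
    using ZF unfolding ZF_model_def by (elim conjE) assumption
  then show ?thesis by (auto simp: is_sub_def subset_iff)
qed

text \<open>Foundation for the singleton of \<open>a\<close>. Later this makes \<open>n\<close> a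
  genuinely new element of its successor.\<close>

lemma not_mem_self: "\<not> a \<^bold>\<in> a"
proof
  assume "a \<^bold>\<in> a"
  have "\<forall>x. (\<exists>y. y \<^bold>\<in> x) \<longrightarrow> (\<exists>y. y \<^bold>\<in> x \<and> \<not> (\<exists>z. z \<^bold>\<in> x \<and> z \<^bold>\<in> y))"
    using ZF unfolding ZF_model_def by (elim conjE) assumption
  moreover obtain p where "ext p = {a, a}"
    using ex_upair by blast
  moreover from this have "z \<^bold>\<in> p \<longleftrightarrow> z = a" for z
    by (auto simp: set_eq_iff)
  ultimately show False using \<open>a \<^bold>\<in> a\<close> by metis
qed

lemma is_sub_iff: "is_sub mem x y \<longleftrightarrow> ext x \<subseteq> ext y"
  by (auto simp: is_sub_def)

lemma is_empty_iff: "is_empty mem x \<longleftrightarrow> ext x = {}"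
  by (simp add: is_empty_def set_eq_iff)

lemma is_upair_iff: "is_upair mem p a b \<longleftrightarrow> ext p = {a, b}"
  by (simp add: is_upair_def set_eq_iff)

lemma is_succ_iff: "is_succ mem s a \<longleftrightarrow> ext s = insert a (ext a)"
  by (simp add: is_succ_def set_eq_iff disj_commute)

lemma ex_succ: "\<exists>s. ext s = insert a (ext a)"
proof -
  obtain p where "ext p = {a, a}" using ex_upair by blast
  then show ?thesis using ex_un[of p a] by auto
qed

lemma is_opair_inj:
  assumes "is_opair mem p a b" "is_opair mem p c d"
  shows "a = c \<and> b = d"
proof -
  obtain u w where 1: "ext u = {a}" "ext w = {a, b}" "ext p = {u, w}"
    using assms(1) by (auto simp: is_opair_def is_upair_iff)
  obtain u' w' where 2: "ext u' = {c}" "ext w' = {c, d}" "ext p = {u', w'}"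
    using assms(2) by (auto simp: is_opair_def is_upair_iff)
  from 1(3) 2(3) have "u = u' \<and> w = w' \<or> u = w' \<and> w = u'"
    by (auto simp: doubleton_eq_iff)
  then show ?thesis
    using 1(1,2) 2(1,2) by (metis doubleton_eq_iff insert_absorb2)
qed

lemma ex1_opair: "\<exists>!p. is_opair mem p a b"
proof -
  obtain u w where uw: "ext u = {a, a}" "ext w = {a, b}" using ex_upair by metis
  moreover obtain p where "ext p = {u, w}" using ex_upair by metis
  ultimately have "is_opair mem p a b"
    unfolding is_opair_def is_upair_iff by blast
  moreover have "p = q" if "is_opair mem p a b" "is_opair mem q a b" for p q
    using that unfolding is_opair_def is_upair_iff by (metis ext_inject)
  ultimately show ?thesis by blast
qed

definition pr :: "'a \<Rightarrow> 'a \<Rightarrow> 'a" where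
  "pr a b = the1 (\<lambda>p. is_opair mem p a b)"

lemma is_opair_iff: "is_opair mem p a b \<longleftrightarrow> p = pr a b"
  using the1I[OF ex1_opair[of a b]] ex1_opair[of a b] unfolding pr_def by blast

lemma pr_inject [simp]: "pr a b = pr c d \<longleftrightarrow> a = c \<and> b = d"
  using is_opair_inj is_opair_iff by metis

lemma maps_to_iff: "maps_to mem f x y \<longleftrightarrow> pr x y \<^bold>\<in> f"
  by (auto simp: maps_to_def is_opair_iff)

section \<open>Definability of the basic notions of set theory\<close>

lemma dfb_is_sub [dfb_intros]: "dft s \<Longrightarrow> dft t \<Longrightarrow> dfb (\<lambda>v. is_sub mem (s v) (t v))"
  by (rule dfb_subst2[where P = "is_sub mem"]; (assumption | unfold is_sub_def, intro dfb_intros))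

lemma dfb_is_empty [dfb_intros]: "dft s \<Longrightarrow> dfb (\<lambda>v. is_empty mem (s v))"
  by (rule dfb_subst1[where P = "is_empty mem"]; (assumption | unfold is_empty_def, intro dfb_intros))

lemma dfb_is_upair [dfb_intros]:
  "dft s \<Longrightarrow> dft t \<Longrightarrow> dft u \<Longrightarrow> dfb (\<lambda>v. is_upair mem (s v) (t v) (u v))"
  by (rule dfb_subst3[where P = "is_upair mem"]; (assumption | unfold is_upair_def, intro dfb_intros))

lemma dfb_is_opair [dfb_intros]:
  "dft s \<Longrightarrow> dft t \<Longrightarrow> dft u \<Longrightarrow> dfb (\<lambda>v. is_opair mem (s v) (t v) (u v))"
  by (rule dfb_subst3[where P = "is_opair mem"]; (assumption | unfold is_opair_def, intro dfb_intros))

lemma dfb_is_succ [dfb_intros]: "dft s \<Longrightarrow> dft t \<Longrightarrow> dfb (\<lambda>v. is_succ mem (s v) (t v))"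
  by (rule dfb_subst2[where P = "is_succ mem"]; (assumption | unfold is_succ_def, intro dfb_intros))

lemma dfb_is_inductive [dfb_intros]: "dft s \<Longrightarrow> dfb (\<lambda>v. is_inductive mem (s v))"
  by (rule dfb_subst1[where P = "is_inductive mem"];
      (assumption | unfold is_inductive_def, intro dfb_intros))

lemma dfb_in_omega [dfb_intros]: "dft s \<Longrightarrow> dfb (\<lambda>v. in_omega mem (s v))"
  by (rule dfb_subst1[where P = "in_omega mem"]; (assumption | unfold in_omega_def, intro dfb_intros))

lemma dfb_maps_to [dfb_intros]:
  "dft s \<Longrightarrow> dft t \<Longrightarrow> dft u \<Longrightarrow> dfb (\<lambda>v. maps_to mem (s v) (t v) (u v))"
  by (rule dfb_subst3[where P = "maps_to mem"]; (assumption | unfold maps_to_def, intro dfb_intros))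

lemma dfb_is_fun [dfb_intros]:
  "dft s \<Longrightarrow> dft t \<Longrightarrow> dft u \<Longrightarrow> dfb (\<lambda>v. is_fun mem (s v) (t v) (u v))"
  by (rule dfb_subst3[where P = "is_fun mem"]; (assumption | unfold is_fun_def, intro dfb_intros))

lemma dfb_is_bij [dfb_intros]:
  "dft s \<Longrightarrow> dft t \<Longrightarrow> dft u \<Longrightarrow> dfb (\<lambda>v. is_bij mem (s v) (t v) (u v))"
  by (rule dfb_subst3[where P = "is_bij mem"]; (assumption | unfold is_bij_def, intro dfb_intros))

lemma dfb_equinumerous [dfb_intros]: "dft s \<Longrightarrow> dft t \<Longrightarrow> dfb (\<lambda>v. equinumerous mem (s v) (t v))"
  by (rule dfb_subst2[where P = "equinumerous mem"];
      (assumption | unfold equinumerous_def, intro dfb_intros))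

lemma dfb_is_subsets_eq [dfb_intros]:
  "dft s \<Longrightarrow> dft t \<Longrightarrow> dft u \<Longrightarrow> dfb (\<lambda>v. is_subsets_eq mem (s v) (t v) (u v))"
  by (rule dfb_subst3[where P = "is_subsets_eq mem"];
      (assumption | unfold is_subsets_eq_def, intro dfb_intros))

lemma dfb_is_subsets_gt [dfb_intros]:
  "dft s \<Longrightarrow> dft t \<Longrightarrow> dft u \<Longrightarrow> dfb (\<lambda>v. is_subsets_gt mem (s v) (t v) (u v))"
  by (rule dfb_subst3[where P = "is_subsets_gt mem"];
      (assumption | unfold is_subsets_gt_def, intro dfb_intros))

lemma dfb_is_product [dfb_intros]:
  "dft s \<Longrightarrow> dft t \<Longrightarrow> dft u \<Longrightarrow> dfb (\<lambda>v. is_product mem (s v) (t v) (u v))"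
  by (rule dfb_subst3[where P = "is_product mem"];
      (assumption | unfold is_product_def, intro dfb_intros))

lemma dft_pr [dfb_intros]: "dft s \<Longrightarrow> dft t \<Longrightarrow> dft (\<lambda>v. pr (s v) (t v))"
  by (rule dft_subst2[where F = pr]; (assumption | unfold pr_def, intro dfb_intros))

definition app :: "'a \<Rightarrow> 'a \<Rightarrow> 'a" where
  "app f x = the1 (\<lambda>y. maps_to mem f x y)"

lemma dft_app [dfb_intros]: "dft s \<Longrightarrow> dft t \<Longrightarrow> dft (\<lambda>v. app (s v) (t v))"
  by (rule dft_subst2[where F = app]; (assumption | unfold app_def, intro dfb_intros))

lemma is_funD:
  assumes "is_fun mem f a b" "x \<^bold>\<in> a"
  shows "maps_to mem f x y \<longleftrightarrow> y = app f x" "app f x \<^bold>\<in> b"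
proof -
  have 1: "\<exists>!y. maps_to mem f x y"
    using assms unfolding is_fun_def by blast
  show "maps_to mem f x y \<longleftrightarrow> y = app f x"
    using 1 the1I[OF 1] unfolding app_def by blast
  have "maps_to mem f x (app f x)"
    unfolding app_def by (rule the1I[OF 1])
  then show "app f x \<^bold>\<in> b"
    using assms unfolding is_fun_def maps_to_iff is_opair_iff by fastforce
qed

text \<open>The graph is the image of \<open>a\<close> under the definable operation sending
  \<open>x\<close> to \<open>pr x (F x)\<close>, hence a set by Replacement.\<close>

lemma ex_fun:
  assumes "dft (\<lambda>v. F (v 0))" "F ` ext a \<subseteq> ext b"
  shows "\<exists>f. is_fun mem f a b \<and> (\<forall>x y. maps_to mem f x y \<longleftrightarrow> x \<^bold>\<in> a \<and> y = F x)"
proof -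
  have "dft (\<lambda>v. pr (v 0) (F (v 0)))"
    by (intro dfb_intros assms)
  then obtain f where f: "ext f = (\<lambda>x. pr x (F x)) ` ext a"
    using ex_image[of "\<lambda>x. pr x (F x)" a] by blast
  have mem_f: "p \<^bold>\<in> f \<longleftrightarrow> (\<exists>x. x \<^bold>\<in> a \<and> p = pr x (F x))" for p
    using f by (simp add: set_eq_iff image_iff Bex_def)
  have 1: "maps_to mem f x y \<longleftrightarrow> x \<^bold>\<in> a \<and> y = F x" for x y
    unfolding maps_to_iff mem_f by auto
  moreover have "F x \<^bold>\<in> b" if "x \<^bold>\<in> a" for x
    using that assms(2) by (simp add: image_subset_iff)
  ultimately have "is_fun mem f a b"
    unfolding is_fun_def is_opair_iff mem_f by auto
  with 1 show ?thesis by blast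
qed

text \<open>
  Equinumerosity of HOL sets by a bijection that is a definable class function; on sets of the
  model it is the internal notion, by Replacement.
\<close>

definition eqv :: "'a set \<Rightarrow> 'a set \<Rightarrow> bool" where
  "eqv A B \<longleftrightarrow> (\<exists>F. dft (\<lambda>v. F (v 0)) \<and> bij_betw F A B)"

lemma equinumerous_iff: "equinumerous mem a b \<longleftrightarrow> eqv (ext a) (ext b)"
proof
  assume "equinumerous mem a b"
  then obtain f where f: "is_fun mem f a b" "\<And>y. y \<^bold>\<in> b \<Longrightarrow> \<exists>!x. maps_to mem f x y"
    unfolding equinumerous_def is_bij_def by blast
  have 1: "x \<^bold>\<in> a" if "maps_to mem f x y" for x y
    using that f(1) unfolding is_fun_def maps_to_iff is_opair_iff by fastforce
  have "bij_betw (app f) (ext a) (ext b)"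
  proof (rule bij_betwI')
    fix x y assume "x \<in> ext a" "y \<in> ext a"
    then show "app f x = app f y \<longleftrightarrow> x = y"
      using is_funD[OF f(1)] f(2) by (metis mem_ext)
  next
    fix x assume "x \<in> ext a"
    then show "app f x \<in> ext b" using is_funD(2)[OF f(1)] by simp
  next
    fix y assume "y \<in> ext b"
    then obtain x where "maps_to mem f x y" using f(2) by (meson mem_ext)
    then show "\<exists>x\<in>ext a. y = app f x" using 1 is_funD(1)[OF f(1)] by (metis mem_ext)
  qed
  moreover have "dft (\<lambda>v. app f (v 0))" by (intro dfb_intros)
  ultimately show "eqv (ext a) (ext b)" unfolding eqv_def by blast
next
  assume "eqv (ext a) (ext b)"
  then obtain F where F: "dft (\<lambda>v. F (v 0))" "bij_betw F (ext a) (ext b)"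
    unfolding eqv_def by blast
  then obtain f where f: "is_fun mem f a b" "\<And>x y. maps_to mem f x y \<longleftrightarrow> x \<^bold>\<in> a \<and> y = F x"
    using ex_fun[OF F(1), of a b] unfolding bij_betw_def by blast
  have "\<exists>!x. maps_to mem f x y" if "y \<^bold>\<in> b" for y
    using that F(2) unfolding f(2) bij_betw_def inj_on_def
    by (metis (no_types, opaque_lifting) imageE mem_ext)
  with f(1) show "equinumerous mem a b"
    unfolding equinumerous_def is_bij_def by blast
qed

lemma eqv_refl: "eqv A A"
  unfolding eqv_def by (intro exI[of _ "\<lambda>x. x"] conjI dfb_intros) (simp add: bij_betw_def)

lemma eqv_trans:
  assumes "eqv A B" "eqv B C"
  shows "eqv A C"
proof -
  obtain F G where F: "dft (\<lambda>v. F (v 0))" "bij_betw F A B" and G: "dft (\<lambda>v. G (v 0))" "bij_betw G B C"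
    using assms unfolding eqv_def by blast
  have "dft (\<lambda>v. (G \<circ> F) (v 0))"
    unfolding o_def by (rule dft_subst1[OF G(1) F(1)])
  with bij_betw_trans[OF F(2) G(2)] show ?thesis
    unfolding eqv_def by (intro exI[of _ "G \<circ> F"] conjI)
qed

text \<open>The inverse bijection must be definable as well. It searches for preimages in
  \<open>A\<close>, which is where definability of \<open>A\<close> enters.\<close>

lemma eqv_sym:
  assumes "dfb (\<lambda>v. v 0 \<in> A)" "eqv A B"
  shows "eqv B A"
proof -
  obtain F where F: "dft (\<lambda>v. F (v 0))" "bij_betw F A B"
    using assms(2) unfolding eqv_def by blast
  define G where "G y = the1 (\<lambda>x. x \<in> A \<and> F x = y)" for y
  have "dft (\<lambda>v. G (v 0))"
    unfolding G_def by (intro dfb_intros assms dft_subst1[OF F(1)])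
  moreover have "G (F x) = x" if "x \<in> A" for x
    unfolding G_def using F(2) that by (intro the1_equality) (auto simp: bij_betw_def inj_on_def)
  then have "bij_betw G B A"
    using F(2) by (intro bij_betw_byWitness[of _ F]) (auto simp: bij_betw_def)
  ultimately show ?thesis unfolding eqv_def by blast
qed

text \<open>The glued bijection branches on membership in \<open>A\<close>, so this membership has
  to be definable.\<close>

lemma eqv_Un:
  assumes "dfb (\<lambda>v. v 0 \<in> A)" "eqv A C" "eqv B D" "A \<inter> B = {}" "C \<inter> D = {}"
  shows "eqv (A \<union> B) (C \<union> D)"
proof -
  obtain F G where F: "dft (\<lambda>v. F (v 0))" "bij_betw F A C" and G: "dft (\<lambda>v. G (v 0))" "bij_betw G B D"
    using assms(2,3) unfolding eqv_def by blast
  have "dft (\<lambda>v. if v 0 \<in> A then F (v 0) else G (v 0))"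
    by (intro dfb_intros assms F G)
  with bij_betw_disjoint_Un[OF F(2) G(2) assms(4,5)] show ?thesis
    unfolding eqv_def by (intro exI[of _ "\<lambda>x. if x \<in> A then F x else G x"] conjI)
qed

lemma eqv_subset: "eqv A B \<Longrightarrow> C \<subseteq> A \<Longrightarrow> \<exists>D\<subseteq>B. eqv C D"
proof -
  assume "C \<subseteq> A" "eqv A B"
  then obtain F where F: "dft (\<lambda>v. F (v 0))" "bij_betw F A B"
    unfolding eqv_def by blast
  with \<open>C \<subseteq> A\<close> have "F ` C \<subseteq> B" "bij_betw F C (F ` C)"
    by (auto simp: bij_betw_def inj_on_subset)
  with F(1) show ?thesis unfolding eqv_def by metis
qed

text \<open>A bijection \<open>F\<close> may send \<open>x\<close> to an element other than
  \<open>y\<close>. In that case the preimage of \<open>y\<close> is redirected to the freed value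
  \<open>F x\<close>; otherwise \<open>F\<close> itself restricts.\<close>

lemma eqv_remove:
  assumes "eqv A (insert y B)" "y \<notin> B" "x \<in> A"
  shows "eqv (A - {x}) B"
proof -
  obtain F where F: "dft (\<lambda>v. F (v 0))" "bij_betw F A (insert y B)"
    using assms(1) unfolding eqv_def by blast
  have "dft (\<lambda>v. if F (v 0) = y then F x else F (v 0))"
    by (intro dfb_intros F)
  moreover have "bij_betw (\<lambda>z. if F z = y then F x else F z) (A - {x}) B"
  proof (rule bij_betw_imageI)
    show "inj_on (\<lambda>z. if F z = y then F x else F z) (A - {x})"
      using F(2) assms(3) unfolding bij_betw_def inj_on_def by (metis DiffE singletonI)
    have image: "F ` A = insert y B" and inj: "inj_on F A" using F(2) by (auto simp: bij_betw_def)
    show "(\<lambda>z. if F z = y then F x else F z) ` (A - {x}) = B"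
    proof (intro subset_antisym image_subsetI)
      fix z assume "z \<in> A - {x}"
      moreover from this have "F z \<noteq> F x" "F z \<in> insert y B" "F x \<in> insert y B"
        using assms(3) inj image by (auto simp: inj_on_def)
      ultimately show "(if F z = y then F x else F z) \<in> B" by auto
    next
      show "B \<subseteq> (\<lambda>z. if F z = y then F x else F z) ` (A - {x})"
      proof
        fix b assume "b \<in> B"
        then obtain z w where z: "z \<in> A" "F z = b" and w: "w \<in> A" "F w = y"
          using image by (metis imageE insertCI)
        have "b \<noteq> y" using \<open>b \<in> B\<close> assms(2) by blast
        show "b \<in> (\<lambda>z. if F z = y then F x else F z) ` (A - {x})"
        \<comment> \<open>If \<open>b\<close> was the value of the removed \<open>x\<close>, the
          redirected element \<open>w\<close> now attains it.\<close>
        proof (cases "z = x")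
          case True
          with z w \<open>b \<noteq> y\<close> show ?thesis by (intro image_eqI[of _ _ w]) auto
        next
          case False
          with z \<open>b \<noteq> y\<close> show ?thesis by (intro image_eqI[of _ _ z]) auto
        qed
      qed
    qed
  qed
  ultimately show ?thesis
    unfolding eqv_def by (intro exI[of _ "\<lambda>z. if F z = y then F x else F z"] conjI)
qed

section \<open>Natural numbers and finite sets of the model\<close>

text \<open>Successors exist and are unique, so the existential successor clause may be read
  universally.\<close>

lemma inductive_iff:
  "is_inductive mem I \<longleftrightarrow> (\<exists>e. ext e = {} \<and> e \<^bold>\<in> I)
    \<and> (\<forall>a s. a \<^bold>\<in> I \<longrightarrow> ext s = insert a (ext a) \<longrightarrow> s \<^bold>\<in> I)"
  unfolding is_inductive_def is_empty_iff is_succ_iff using ex_succ by (metis ext_inject)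

lemma in_omega_zero: "ext e = {} \<Longrightarrow> in_omega mem e"
  unfolding in_omega_def inductive_iff by (metis ext_inject)

lemma in_omega_succ: "in_omega mem n \<Longrightarrow> ext s = insert n (ext n) \<Longrightarrow> in_omega mem s"
  unfolding in_omega_def inductive_iff by blast

text \<open>Separation cuts an inductive set down to its numbers satisfying \<open>P\<close>; the
  result is inductive, so it contains \<open>n\<close>. Definability of \<open>P\<close> is what
  makes this cut a set of the model.\<close>

lemma omega_induct [consumes 1, case_names dfb zero succ]:
  assumes "in_omega mem n"
    and dfb: "dfb (\<lambda>v. P (v 0))"
    and zero: "\<And>e. ext e = {} \<Longrightarrow> P e"
    and succ: "\<And>n s. in_omega mem n \<Longrightarrow> P n \<Longrightarrow> ext s = insert n (ext n) \<Longrightarrow> P s"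
  shows "P n"
proof -
  have "\<exists>I. is_inductive mem I"
    using ZF unfolding ZF_model_def by (elim conjE) assumption
  then obtain I where I: "is_inductive mem I" by blast
  \<comment> \<open>Including \<open>in_omega\<close> makes it available as a hypothesis in the
    successor step.\<close>
  have "dfb (\<lambda>v. in_omega mem (v 0) \<and> P (v 0))"
    by (intro dfb_intros dfb)
  from ex_separation[of "\<lambda>x. in_omega mem x \<and> P x", OF this]
  obtain J where J: "ext J = {x. x \<^bold>\<in> I \<and> in_omega mem x \<and> P x}" by blast
  then have mem_J: "x \<^bold>\<in> J \<longleftrightarrow> x \<^bold>\<in> I \<and> in_omega mem x \<and> P x" for x
    by (simp add: set_eq_iff)
  have "is_inductive mem J"
    using I in_omega_zero in_omega_succ zero succ unfolding inductive_iff mem_J by blast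
  then show ?thesis
    using assms(1) mem_J unfolding in_omega_def by blast
qed

lemma omega_trans:
  assumes "in_omega mem n" "m \<^bold>\<in> n"
  shows "in_omega mem m" "ext m \<subseteq> ext n"
proof -
  have "\<forall>m. m \<^bold>\<in> n \<longrightarrow> in_omega mem m \<and> is_sub mem m n"
    using assms(1)
  proof (induction rule: omega_induct)
    case dfb show ?case by (intro dfb_intros)
  next
    case (zero e) then show ?case by (metis empty_iff mem_ext)
  next
    case (succ n s)
    then have "m \<^bold>\<in> s \<longleftrightarrow> m = n \<or> m \<^bold>\<in> n" for m by (simp add: set_eq_iff)
    with succ show ?case by (auto simp: is_sub_iff)
  qed
  then show "in_omega mem m" "ext m \<subseteq> ext n"
    using assms(2) by (auto simp: is_sub_iff)
qed

lemma omega_linear: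
  assumes "in_omega mem n" "in_omega mem m"
  shows "m \<^bold>\<in> n \<or> m = n \<or> n \<^bold>\<in> m"
proof -
  have "\<forall>m. in_omega mem m \<longrightarrow> m \<^bold>\<in> n \<or> m = n \<or> n \<^bold>\<in> m"
    using assms(1)
  proof (induction rule: omega_induct)
    case dfb show ?case by (intro dfb_intros)
  next
    case (zero e)
    have "m = e \<or> e \<^bold>\<in> m" if "in_omega mem m" for m
      using that
    proof (induction rule: omega_induct)
      case dfb show ?case by (intro dfb_intros)
    next
      case (zero e') with \<open>ext e = {}\<close> show ?case by (metis ext_inject)
    next
      case (succ n s)
      then show ?case by (metis insert_iff mem_ext)
    qed
    then show ?case by blast
  next
    case (succ n s)
    \<comment> \<open>There is nothing strictly between \<open>k\<close> and its successor. This
      settles the case where \<open>n\<close> lies in \<open>m\<close> when \<open>m\<close> is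
      compared with the successor of \<open>n\<close>.\<close>
    have *: "\<forall>k. k \<^bold>\<in> m \<longrightarrow> (\<exists>s. is_succ mem s k \<and> (s = m \<or> s \<^bold>\<in> m))" if "in_omega mem m" for m
      using that
    proof (induction rule: omega_induct)
      case dfb show ?case by (intro dfb_intros)
    next
      case (zero e) then show ?case by (metis empty_iff mem_ext)
    next
      case (succ n s)
      then have "m \<^bold>\<in> s \<longleftrightarrow> m = n \<or> m \<^bold>\<in> n" for m by (simp add: set_eq_iff)
      with succ show ?case by (metis is_succ_iff)
    qed
    from succ(2) have "m \<^bold>\<in> s \<longleftrightarrow> m = n \<or> m \<^bold>\<in> n" for m by (simp add: set_eq_iff)
    with succ * show ?case by (metis ext_inject is_succ_iff)
  qed
  with assms(2) show ?thesis by blast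
qed

text \<open>Internal induction: a finite ordinal is not equinumerous to a proper subset of itself.
  In the successor step one element is removed from \<open>b\<close>, and the induction hypothesis
  identifies the rest with \<open>n\<close>.\<close>

lemma pigeonhole:
  assumes "in_omega mem n" "ext b \<subseteq> ext n" "eqv (ext b) (ext n)"
  shows "b = n"
proof -
  have "\<forall>b. is_sub mem b n \<and> equinumerous mem b n \<longrightarrow> b = n"
    using assms(1)
  proof (induction rule: omega_induct)
    case dfb show ?case by (intro dfb_intros)
  next
    case (zero e) then show ?case by (simp flip: ext_inject add: is_sub_iff)
  next
    case (succ n s)
    have IH: "ext b = ext n" if "ext b \<subseteq> ext n" "eqv (ext b) (ext n)" for b
      using succ that by (simp add: is_sub_iff equinumerous_iff)
    have "b = s" if b: "ext b \<subseteq> ext s" "eqv (ext b) (ext s)" for b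
    proof -
      have minus: "ext b - {x} = ext n" if "x \<^bold>\<in> b" "ext b - {x} \<subseteq> ext n" for x
      proof -
        have "dfb (\<lambda>v. v 0 \<noteq> x)" by (intro dfb_intros)
        from ex_separation[of "\<lambda>y. y \<noteq> x" b, OF this]
        obtain c where c: "ext c = ext b - {x}" by (auto simp: ext_def set_diff_eq)
        have "eqv (ext b - {x}) (ext n)"
          using b(2) that(1) succ(2) not_mem_self[of n] by (intro eqv_remove[of _ n]) auto
        with IH[of c] c that(2) show ?thesis by simp
      qed
      show "b = s"
      proof (cases "n \<^bold>\<in> b")
        case True
        with minus[of n] b(1) succ(2) have "ext b - {n} = ext n" by auto
        with True succ(2) have "ext b = ext s" by auto
        then show ?thesis by simp
      next
        \<comment> \<open>This case is contradictory: \<open>b\<close> lies inside \<open>n\<close>,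
          yet removing any \<open>x\<close> from \<open>b\<close> leaves all of \<open>n\<close>,
          including \<open>x\<close>.\<close>
        case False
        with b(1) succ(2) have "ext b \<subseteq> ext n" by auto
        moreover have "ext b \<noteq> {}"
          using b(2) succ(2) unfolding eqv_def bij_betw_def by auto
        then obtain x where "x \<^bold>\<in> b" by (auto simp: ext_def)
        ultimately have "ext b - {x} = ext n" "x \<in> ext n" using minus[of x] by auto
        then show ?thesis by blast
      qed
    qed
    then show ?case by (simp add: is_sub_iff equinumerous_iff)
  qed
  then show ?thesis using assms by (simp add: is_sub_iff equinumerous_iff)
qed

text \<open>In the successor step the top element \<open>n\<close> is split off if it is in
  \<open>b\<close>. The rest has some size \<open>m\<close>, and sending \<open>n\<close> to
  \<open>m\<close> gives \<open>b\<close> the size of the successor of \<open>m\<close>.\<close>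

lemma finite_subset_omega:
  assumes "in_omega mem n" "ext b \<subseteq> ext n"
  shows "\<exists>m. in_omega mem m \<and> eqv (ext b) (ext m)"
proof -
  have "\<forall>b. is_sub mem b n \<longrightarrow> (\<exists>m. in_omega mem m \<and> equinumerous mem b m)"
    using assms(1)
  proof (induction rule: omega_induct)
    case dfb show ?case by (intro dfb_intros)
  next
    case (zero e)
    then have "b = e" if "is_sub mem b e" for b
      using that by (simp flip: ext_inject add: is_sub_iff)
    with zero show ?case
      using in_omega_zero eqv_refl equinumerous_iff by metis
  next
    case (succ n s)
    have IH: "\<exists>m. in_omega mem m \<and> eqv (ext b) (ext m)" if "ext b \<subseteq> ext n" for b
      using succ that by (simp add: is_sub_iff equinumerous_iff)
    have "\<exists>m. in_omega mem m \<and> eqv (ext b) (ext m)" if b: "ext b \<subseteq> ext s" for b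
    proof (cases "n \<^bold>\<in> b")
      case True
      have "dfb (\<lambda>v. v 0 \<noteq> n)" by (intro dfb_intros)
      from ex_separation[of "\<lambda>y. y \<noteq> n" b, OF this]
      obtain c where c: "ext c = ext b - {n}" by (auto simp: ext_def set_diff_eq)
      with b succ(2) have "ext c \<subseteq> ext n" by auto
      then obtain m where m: "in_omega mem m" "eqv (ext c) (ext m)" using IH by blast
      obtain t where t: "ext t = insert m (ext m)" using ex_succ by blast
      have "eqv {n} {m}"
        unfolding eqv_def by (intro exI[of _ "\<lambda>_. m"] conjI dfb_intros) (simp add: bij_betw_def)
      moreover have "dfb (\<lambda>v. v 0 \<in> ext c)" unfolding mem_ext by (intro dfb_intros)
      ultimately have "eqv (ext c \<union> {n}) (ext m \<union> {m})"
        using m(2) c not_mem_self[of m] by (intro eqv_Un) auto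
      moreover have "ext c \<union> {n} = ext b" unfolding c using True by (simp add: insert_absorb)
      ultimately have "eqv (ext b) (ext t)" unfolding t by simp
      with in_omega_succ[OF m(1) t] show ?thesis by blast
    next
      case False
      with b succ(2) have "ext b \<subseteq> ext n" by auto
      then show ?thesis by (rule IH)
    qed
    then show ?case by (simp add: is_sub_iff equinumerous_iff)
  qed
  then show ?thesis using assms by (simp add: is_sub_iff equinumerous_iff)
qed

text \<open>Defined through \<open>the1\<close>, union and difference become definable terms, as the
  operation built in \<open>selector_add\<close> requires.\<close>

definition un :: "'a \<Rightarrow> 'a \<Rightarrow> 'a" where
  "un a b = the1 (\<lambda>u. \<forall>z. z \<^bold>\<in> u \<longleftrightarrow> z \<^bold>\<in> a \<or> z \<^bold>\<in> b)"

definition diff :: "'a \<Rightarrow> 'a \<Rightarrow> 'a" where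
  "diff a b = the1 (\<lambda>u. \<forall>z. z \<^bold>\<in> u \<longleftrightarrow> z \<^bold>\<in> a \<and> \<not> z \<^bold>\<in> b)"

lemma dft_un [dfb_intros]: "dft s \<Longrightarrow> dft t \<Longrightarrow> dft (\<lambda>v. un (s v) (t v))"
  by (rule dft_subst2[where F = un]; (assumption | unfold un_def, intro dfb_intros))

lemma dft_diff [dfb_intros]: "dft s \<Longrightarrow> dft t \<Longrightarrow> dft (\<lambda>v. diff (s v) (t v))"
  by (rule dft_subst2[where F = diff]; (assumption | unfold diff_def, intro dfb_intros))

lemma ext_the1:
  assumes "ext u = {z. P z}"
  shows "ext (the1 (\<lambda>u. \<forall>z. z \<^bold>\<in> u \<longleftrightarrow> P z)) = {z. P z}"
proof -
  have *: "(\<forall>z. z \<^bold>\<in> w \<longleftrightarrow> P z) \<longleftrightarrow> w = u" for w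
    unfolding ext_inject[symmetric] assms by (auto simp: ext_def)
  show ?thesis unfolding * using assms by (simp add: the1_def)
qed

lemma ext_un [simp]: "ext (un a b) = ext a \<union> ext b"
proof -
  obtain u where "ext u = ext a \<union> ext b" using ex_un by blast
  then have "ext u = {z. z \<^bold>\<in> a \<or> z \<^bold>\<in> b}" by (simp add: set_eq_iff)
  from ext_the1[OF this] show ?thesis by (simp add: un_def set_eq_iff)
qed

lemma ext_diff [simp]: "ext (diff a b) = ext a - ext b"
proof -
  have "dfb (\<lambda>v. \<not> v 0 \<^bold>\<in> b)" by (intro dfb_intros)
  from ex_separation[of "\<lambda>z. \<not> z \<^bold>\<in> b" a, OF this]
  obtain u where "ext u = {z. z \<^bold>\<in> a \<and> \<not> z \<^bold>\<in> b}" by blast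
  from ext_the1[OF this] show ?thesis by (simp add: diff_def set_eq_iff)
qed

section \<open>Comparison of finite sizes by embeddings\<close>

lemma dfb_ext: "dfb (\<lambda>v. v 0 \<in> ext a)"
  unfolding mem_ext by (intro dfb_intros)

text \<open>\<open>B\<close> is the image of a set under a definable operation, so Replacement
  applies.\<close>

lemma eqv_ext_ex:
  assumes "eqv (ext a) B"
  shows "\<exists>b. ext b = B"
proof -
  obtain F where "dft (\<lambda>v. F (v 0))" "bij_betw F (ext a) B"
    using assms unfolding eqv_def by blast
  then show ?thesis using ex_image[of F a] by (simp add: bij_betw_def)
qed

lemma finite_subset:
  assumes "in_omega mem n" "eqv (ext a) (ext n)" "ext b \<subseteq> ext a"
  shows "\<exists>m. in_omega mem m \<and> eqv (ext b) (ext m)"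
proof -
  obtain E where E: "E \<subseteq> ext n" "eqv (ext b) E"
    using eqv_subset[OF assms(2,3)] by blast
  obtain e where "ext e = E" using eqv_ext_ex[OF E(2)] by blast
  with E finite_subset_omega[OF assms(1), of e] eqv_trans show ?thesis by blast
qed

text \<open>This replaces arithmetic on omega. If \<open>n\<close> is not in \<open>m\<close>,
  linearity and transitivity give that \<open>m\<close> is a subset of \<open>n\<close>, and the
  bijections carry this inclusion into \<open>c\<close>.\<close>

lemma eqv_subset_or_mem:
  assumes "in_omega mem m" "in_omega mem n" "eqv A (ext m)" "eqv (ext c) (ext n)"
  shows "n \<^bold>\<in> m \<or> (\<exists>D\<subseteq>ext c. eqv A D)"
proof (cases "n \<^bold>\<in> m")
  case False
  then have "ext m \<subseteq> ext n"
    using omega_linear[OF assms(1,2)] omega_trans(2)[OF assms(2), of m] by blast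
  then obtain D where "D \<subseteq> ext c" "eqv (ext m) D"
    using eqv_subset[OF eqv_sym[OF dfb_ext assms(4)]] by blast
  with eqv_trans[OF assms(3)] show ?thesis by blast
qed simp

text \<open>The converse direction: an embedding would make \<open>m\<close> equinumerous to a
  subset of \<open>n\<close>, which lies in \<open>m\<close> but misses the element
  \<open>n\<close>, against \<open>pigeonhole\<close>.\<close>

lemma not_eqv_subset:
  assumes "in_omega mem m" "n \<^bold>\<in> m" "eqv (ext a) (ext m)" "eqv C (ext n)" "D \<subseteq> C"
  shows "\<not> eqv (ext a) D"
proof
  assume "eqv (ext a) D"
  obtain E where E: "E \<subseteq> ext n" "eqv D E"
    using eqv_subset[OF assms(4,5)] by blast
  have 1: "eqv (ext m) E"
    using eqv_trans[OF eqv_sym[OF dfb_ext assms(3)] eqv_trans[OF \<open>eqv (ext a) D\<close> E(2)]] .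
  obtain e where e: "ext e = E" using eqv_ext_ex[OF 1] by blast
  have "e = m"
    using assms(1)
  proof (rule pigeonhole)
    show "ext e \<subseteq> ext m" using omega_trans(2)[OF assms(1,2)] E(1) e by blast
    show "eqv (ext e) (ext m)" unfolding e by (rule eqv_sym[OF dfb_ext 1])
  qed
  then have "n \<in> ext n" using E(1) e assms(2) by auto
  then show False using not_mem_self by simp
qed

section \<open>The sets of subsets of prescribed size\<close>

lemma ex_subsets_eq: "\<exists>s. is_subsets_eq mem s x n"
proof -
  obtain p where p: "\<And>z. z \<^bold>\<in> p \<longleftrightarrow> ext z \<subseteq> ext x" using ex_pow by blast
  have "dfb (\<lambda>v. equinumerous mem (v 0) n)" by (intro dfb_intros)
  from separation[of "\<lambda>z. equinumerous mem z n", OF this, of p]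
  show ?thesis unfolding is_subsets_eq_def p is_sub_iff .
qed

lemma ex_subsets_gt: "\<exists>s. is_subsets_gt mem s x n"
proof -
  obtain p where p: "\<And>z. z \<^bold>\<in> p \<longleftrightarrow> ext z \<subseteq> ext x" using ex_pow by blast
  have "dfb (\<lambda>v. \<exists>m. in_omega mem m \<and> n \<^bold>\<in> m \<and> equinumerous mem (v 0) m)" by (intro dfb_intros)
  from separation[of "\<lambda>z. \<exists>m. in_omega mem m \<and> n \<^bold>\<in> m \<and> equinumerous mem z m", OF this, of p]
  show ?thesis unfolding is_subsets_gt_def p is_sub_iff .
qed

section \<open>Selecting subsets of a fixed size\<close>

text \<open>The core of \<open>nRC_fin\<close> for a fixed \<open>y\<close>. Being first-order, it
  may occur in an internal induction.\<close>

definition selector :: "'a \<Rightarrow> 'a \<Rightarrow> 'a \<Rightarrow> bool" where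
  "selector g y n \<longleftrightarrow> (\<exists>a b. is_subsets_gt mem a y n \<and> is_subsets_eq mem b y n \<and> is_fun mem g a b \<and>
    (\<forall>z w. z \<^bold>\<in> a \<longrightarrow> maps_to mem g z w \<longrightarrow> is_sub mem w z))"

lemma nRC_fin_iff:
  "nRC_fin mem n \<longleftrightarrow> (\<forall>x. is_infinite mem x \<longrightarrow>
    (\<exists>y g. is_sub mem y x \<and> is_infinite mem y \<and> selector g y n))"
  unfolding nRC_fin_def selector_def by blast

lemma dfb_selector [dfb_intros]:
  "dft s \<Longrightarrow> dft t \<Longrightarrow> dft u \<Longrightarrow> dfb (\<lambda>v. selector (s v) (t v) (u v))"
  by (rule dfb_subst3[where P = selector]; (assumption | unfold selector_def, intro dfb_intros))

lemma selectorD: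
  assumes "selector g y n" "ext z \<subseteq> ext y" "in_omega mem m" "n \<^bold>\<in> m" "eqv (ext z) (ext m)"
  shows "ext (app g z) \<subseteq> ext z" "eqv (ext (app g z)) (ext n)"
proof -
  obtain a b where a: "is_subsets_gt mem a y n" and b: "is_subsets_eq mem b y n"
    and g: "is_fun mem g a b" and sub: "\<And>z w. z \<^bold>\<in> a \<Longrightarrow> maps_to mem g z w \<Longrightarrow> is_sub mem w z"
    using assms(1) unfolding selector_def by blast
  have z: "z \<^bold>\<in> a"
    using a assms(2-5) unfolding is_subsets_gt_def is_sub_iff equinumerous_iff by blast
  show "ext (app g z) \<subseteq> ext z"
    using sub[OF z] is_funD(1)[OF g z] unfolding is_sub_iff by blast
  show "eqv (ext (app g z)) (ext n)"
    using b is_funD(2)[OF g z] unfolding is_subsets_eq_def equinumerous_iff by blast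
qed

text \<open>Turns a definable choice of subsets into a function that is a set of the model.\<close>

lemma ex_selector:
  assumes "dft (\<lambda>v. G (v 0))"
    and "\<And>z m. ext z \<subseteq> ext y \<Longrightarrow> in_omega mem m \<Longrightarrow> n \<^bold>\<in> m \<Longrightarrow> eqv (ext z) (ext m) \<Longrightarrow>
      ext (G z) \<subseteq> ext z \<and> eqv (ext (G z)) (ext n)"
  shows "\<exists>g. selector g y n"
proof -
  obtain a b where a: "is_subsets_gt mem a y n" and b: "is_subsets_eq mem b y n"
    using ex_subsets_gt ex_subsets_eq by blast
  have G: "ext z \<subseteq> ext y \<and> ext (G z) \<subseteq> ext z \<and> eqv (ext (G z)) (ext n)" if "z \<^bold>\<in> a" for z
    using that a assms(2)[of z] unfolding is_subsets_gt_def is_sub_iff equinumerous_iff by blast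
  have "G z \<^bold>\<in> b" if "z \<^bold>\<in> a" for z
    using b G[OF that] unfolding is_subsets_eq_def is_sub_iff equinumerous_iff by blast
  then have "G ` ext a \<subseteq> ext b" by (simp add: image_subset_iff)
  from ex_fun[OF assms(1) this] obtain g
    where g: "is_fun mem g a b" "\<And>x y. maps_to mem g x y \<longleftrightarrow> x \<^bold>\<in> a \<and> y = G x" by blast
  have "is_sub mem w z" if "z \<^bold>\<in> a" "maps_to mem g z w" for z w
    using that G[of z] by (simp add: g(2) is_sub_iff)
  with a b g(1) show ?thesis unfolding selector_def by meson
qed

text \<open>
  From \<open>z\<close> remove the subset \<open>w\<close> of size \<open>m\<close> given by \<open>g\<close>; more than \<open>n\<close> elements remain, so \<open>f\<close>
  applies to \<open>z - w\<close>.
\<close>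

lemma selector_add:
  assumes omega: "in_omega mem m" "in_omega mem n"
    and c: "eqv (ext c) (ext m)" and d: "eqv (ext d) (ext n)"
    and e: "ext e = ext c \<union> ext d" "ext c \<inter> ext d = {}" "eqv (ext e) (ext l)"
    and g: "selector g y m" and f: "selector f y n"
  shows "\<exists>h. selector h y l"
proof (rule ex_selector)
  show "dft (\<lambda>v. un (app g (v 0)) (app f (diff (v 0) (app g (v 0)))))"
    by (intro dfb_intros)
next
  fix z M
  assume z: "ext z \<subseteq> ext y" and M: "in_omega mem M" "l \<^bold>\<in> M" "eqv (ext z) (ext M)"
  note not_eqv = not_eqv_subset[OF M e(3)]
  \<comment> \<open>Here \<open>e\<close> represents the sum of \<open>m\<close> and
    \<open>n\<close>. Otherwise \<open>z\<close> would embed into \<open>c\<close>, a part of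
    \<open>e\<close>, although its size exceeds \<open>l\<close>.\<close>
  have "m \<^bold>\<in> M"
    using eqv_subset_or_mem[OF M(1) omega(1) M(3) c] not_eqv e(1) by blast
  define w where "w = app g z"
  have w: "ext w \<subseteq> ext z" "eqv (ext w) (ext m)"
    unfolding w_def using selectorD[OF g z M(1) \<open>m \<^bold>\<in> M\<close> M(3)] by blast+
  have wc: "eqv (ext w) (ext c)"
    using eqv_trans[OF w(2) eqv_sym[OF dfb_ext c]] .
  define u where "u = diff z w"
  have u: "ext u = ext z - ext w" unfolding u_def by simp
  then obtain N where N: "in_omega mem N" "eqv (ext u) (ext N)"
    using finite_subset[OF M(1,3), of u] by blast
  \<comment> \<open>If the remainder \<open>u\<close> embedded into \<open>d\<close>, then
    \<open>z\<close>, the union of \<open>w\<close> and \<open>u\<close>, would embed into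
    \<open>e\<close>.\<close>
  have "\<not> eqv (ext u) D" if "D \<subseteq> ext d" for D
  proof
    assume "eqv (ext u) D"
    then have "eqv (ext w \<union> ext u) (ext c \<union> D)"
      using that u e(2) by (intro eqv_Un dfb_ext wc) auto
    moreover have "ext w \<union> ext u = ext z" using u w(1) by blast
    ultimately show False using not_eqv[of "ext c \<union> D"] e(1) that by auto
  qed
  then have "n \<^bold>\<in> N"
    using eqv_subset_or_mem[OF N(1) omega(2) N(2) d] by blast
  have "ext u \<subseteq> ext y" using u z by blast
  note fu = selectorD[OF f this N(1) \<open>n \<^bold>\<in> N\<close> N(2)]
  have "eqv (ext w \<union> ext (app f u)) (ext c \<union> ext d)"
    using u e(2) fu(1) by (intro eqv_Un dfb_ext wc eqv_trans[OF fu(2) eqv_sym[OF dfb_ext d]]) auto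
  then have "eqv (ext w \<union> ext (app f u)) (ext l)"
    using eqv_trans e(1,3) by metis
  then show "ext (un (app g z) (app f (diff z (app g z)))) \<subseteq> ext z
    \<and> eqv (ext (un (app g z) (app f (diff z (app g z))))) (ext l)"
    unfolding ext_un w_def[symmetric] u_def[symmetric] using w(1) u fu(1) by blast
qed

lemma is_product_iff:
  "is_product mem c a b \<longleftrightarrow> ext c = {pr x y |x y. x \<^bold>\<in> a \<and> y \<^bold>\<in> b}"
  by (auto simp: is_product_def is_opair_iff set_eq_iff)

text \<open>Internal induction on \<open>k\<close> with \<open>f\<close>, \<open>y\<close> and
  \<open>n\<close> fixed. The product \<open>c\<close> and its size \<open>m\<close> change with
  \<open>k\<close>, so they are quantified inside the induction predicate.\<close>

lemma selector_mult:
  assumes "in_omega mem k" "in_omega mem n" "selector f y n"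
    and "is_product mem c k n" "in_omega mem m" "equinumerous mem c m"
  shows "\<exists>g. selector g y m"
proof -
  have "\<forall>c m. is_product mem c k n \<and> in_omega mem m \<and> equinumerous mem c m
    \<longrightarrow> (\<exists>g. selector g y m)"
    using assms(1)
  proof (induction rule: omega_induct)
    case dfb show ?case by (intro dfb_intros)
  next
    case (zero e)
    then have e: "\<not> x \<^bold>\<in> e" for x by (simp add: set_eq_iff)
    have "\<exists>g. selector g y m" if "is_product mem c e n" "equinumerous mem c m" for c m
    proof (rule ex_selector)
      \<comment> \<open>For \<open>k\<close> empty the product is empty, so the empty set is chosen
        from every \<open>z\<close>.\<close>
      show "dft (\<lambda>v. e)" by (intro dfb_intros)
      have "ext c = ext e" using that(1) e zero by (simp add: is_product_iff)
      with that(2) show "ext e \<subseteq> ext z \<and> eqv (ext e) (ext m)" for z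
        using zero by (simp add: equinumerous_iff)
    qed
    then show ?case by blast
  next
    case (succ k s)
    have s: "x \<^bold>\<in> s \<longleftrightarrow> x = k \<or> x \<^bold>\<in> k" for x
      using succ(2) by (simp add: set_eq_iff)
    have "\<exists>g. selector g y m" if c: "is_product mem c s n" "in_omega mem m" "equinumerous mem c m" for c m
    proof -
      \<comment> \<open>The product over the successor of \<open>k\<close> splits into
        \<open>c'\<close>, the pairs over \<open>k\<close>, and \<open>d\<close>, a copy of
        \<open>n\<close> consisting of the pairs with first component \<open>k\<close>.\<close>
      have "dfb (\<lambda>v. \<exists>x. x \<^bold>\<in> k \<and> (\<exists>i. v 0 = pr x i))" by (intro dfb_intros)
      from ex_separation[of "\<lambda>p. \<exists>x. x \<^bold>\<in> k \<and> (\<exists>i. p = pr x i)" c, OF this]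
      obtain c' where "ext c' = {p. p \<^bold>\<in> c \<and> (\<exists>x. x \<^bold>\<in> k \<and> (\<exists>i. p = pr x i))}" by blast
      moreover have mem_c: "p \<^bold>\<in> c \<longleftrightarrow> (\<exists>x y. (x = k \<or> x \<^bold>\<in> k) \<and> y \<^bold>\<in> n \<and> p = pr x y)" for p
        using c(1) by (simp add: is_product_def is_opair_iff s)
      ultimately have c': "ext c' = {pr x i |x i. x \<^bold>\<in> k \<and> i \<^bold>\<in> n}" by auto
      have pair: "dft (\<lambda>v. pr k (v 0))" by (intro dfb_intros)
      obtain d where d: "ext d = pr k ` ext n" using ex_image[OF pair] by blast
      have dn: "eqv (ext n) (ext d)"
        unfolding eqv_def d by (intro exI[of _ "pr k"] conjI pair) (simp add: bij_betw_def inj_on_def)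
      have un: "ext c = ext c' \<union> ext d"
        unfolding c' d by (auto simp: ext_def mem_c)
      \<comment> \<open>A common pair would put \<open>k\<close> into itself.\<close>
      have disj: "ext c' \<inter> ext d = {}"
        unfolding c' d using not_mem_self by auto
      have cm: "eqv (ext c) (ext m)" using c(3) by (simp add: equinumerous_iff)
      \<comment> \<open>The product of \<open>k\<close> and \<open>n\<close> as an element of omega
        arises as the size of a subset of the finite set \<open>c\<close>.\<close>
      obtain m' where m': "in_omega mem m'" "eqv (ext c') (ext m')"
        using finite_subset[OF c(2) cm, of c'] un by blast
      have "is_product mem c' k n" using c' by (simp add: is_product_iff)
      with succ.IH m' obtain g where "selector g y m'"
        unfolding equinumerous_iff by blast
      then show ?thesis
        using selector_add[OF m'(1) assms(2) m'(2) eqv_sym[OF dfb_ext dn] un disj cm] assms(3) by blast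
    qed
    then show ?case by blast
  qed
  with assms(4-6) show ?thesis by blast
qed

end

theorem lemma8p1:
  fixes mem :: "'a \<Rightarrow> 'a \<Rightarrow> bool" and k n m :: 'a
  assumes "ZF_model mem"
    and "in_omega mem k" and "in_omega mem n"
    and "is_mult mem m k n"
    and "nRC_fin mem n"
  shows "nRC_fin mem m"
proof -
  interpret zf mem by unfold_locales (rule assms(1))
  from assms(4) obtain c where "is_product mem c k n" "in_omega mem m" "equinumerous mem c m"
    unfolding is_mult_def by blast
  \<comment> \<open>The infinite subset \<open>y\<close> supplied for \<open>n\<close> also serves
    for \<open>m\<close>; only the selector changes.\<close>
  then have "\<exists>h. selector h y m" if "selector g y n" for g y
    using selector_mult[OF assms(2,3) that] by blast
  with assms(5) show ?thesis unfolding nRC_fin_iff by meson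
qed

end
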